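(* Let $E$ be a complex Banach space, let $I=\mathbb{R}$ or $I=[0,\infty)$, and let $f:I\to E$ be a continuous function. Let $c\in\mathbb{C}$ with $|c|=1$ and suppose that $\arg(c)=\pi p/q$, where $p\in\mathbb{Z}\setminus\{0\}$, $q\in\mathbb{N}$ and $\gcd(p,q)=1$. (i) If $p$ is even and $f$ is $c$-almost periodic (respectively $c$-uniformly recurrent, semi-$c$-periodic), then $f$ is almost periodic (respectively uniformly recurrent, semi-periodic). (ii) If $p$ is odd and $f$ is $c$-almost periodic (respectively $c$-uniformly recurrent, semi-$c$-periodic), then $f$ is almost anti-periodic (respectively uniformly anti-recurrent, semi-anti-periodic).
   Context: $\mathbb{N}=\{1,2,\dots\}$; $\mathbb{S}:=\mathbb{N}$ if $I=[0,\infty)$ and $\mathbb{S}:=\mathbb{Z}$ if $I=\mathbb{R}$; $\arg(c)\in(-\pi,\pi]$. Let $f:I\to E$ be continuous and $|c|=1$. $f$ is $c$-almost periodic if for each $\epsilon>0$ the set of all $\tau>0$ such that $\|f(t+\tau)-cf(t)\|\le\epsilon$ for all $t\in I$ is relatively dense in $[0,\infty)$, i.e. there exists $L>0$ such that every subinterval of $[0,\infty)$ of length $L$ meets this set. $f$ is $c$-uniformly recurrent if there exists a strictly increasing sequence $(\alpha_n)$ of positive reals with $\alpha_n\to+\infty$ and $\lim_{n\to\infty}\sup_{t\in I}\|f(t+\alpha_n)-cf(t)\|=0$. $f$ is semi-$c$-periodic if for every $\varepsilon>0$ there exists $r>0$ such that $\|f(x+mr)-c^{m}f(x)\|\le\varepsilon$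 for all $m\in\mathbb{S}$ and all $x\in I$. Almost periodic, uniformly recurrent, semi-periodic mean the respective notions with $c=1$; almost anti-periodic, uniformly anti-recurrent, semi-anti-periodic mean the respective notions with $c=-1$. *)

theory Defs
  imports "HOL-Analysis.Analysis"
begin

(* The libraries only provide real normed spaces.  A complex Banach space is a real Banach
   space with a complex scalar multiplication extending the real one and such that the norm
   is absolutely homogeneous over the complex numbers. *)

class complex_banach = banach +
  fixes scaleC :: "complex \<Rightarrow> 'a \<Rightarrow> 'a"  (infixr \<open>*\<^sub>C\<close> 75)
  assumes scaleC_add_right: "a *\<^sub>C (x + y) = a *\<^sub>C x + a *\<^sub>C y"
    and scaleC_add_left: "(a + b) *\<^sub>C x = a *\<^sub>C x + b *\<^sub>C x"
    and scaleC_scaleC: "a *\<^sub>C (b *\<^sub>C x) = (a * b) *\<^sub>C x"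
    and scaleR_scaleC: "r *\<^sub>R x = complex_of_real r *\<^sub>C x"
    and norm_scaleC: "norm (a *\<^sub>C x) = cmod a * norm x"

instantiation complex :: complex_banach
begin

definition scaleC_complex :: "complex \<Rightarrow> complex \<Rightarrow> complex"
  where "scaleC_complex a x = a * x"

instance
  by standard (simp_all add: scaleC_complex_def algebra_simps norm_mult scaleR_conv_of_real)

end

definition relatively_dense :: "real set \<Rightarrow> bool"
  where "relatively_dense T \<longleftrightarrow>
    (\<exists>L>0. \<forall>a\<ge>0. {a..a + L} \<inter> T \<noteq> {})"

definition c_almost_periodic ::
    "complex \<Rightarrow> real set \<Rightarrow> (real \<Rightarrow> 'a::complex_banach) \<Rightarrow> bool"
  where "c_almost_periodic c I f \<longleftrightarrow>
    (\<forall>\<epsilon>>0. relatively_dense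
      {\<tau>. \<tau> > 0 \<and> (\<forall>t\<in>I. norm (f (t + \<tau>) - c *\<^sub>C f t) \<le> \<epsilon>)})"

(* The supremum is taken in the extended reals because it may be infinite for some n. *)

definition c_uniformly_recurrent ::
    "complex \<Rightarrow> real set \<Rightarrow> (real \<Rightarrow> 'a::complex_banach) \<Rightarrow> bool"
  where "c_uniformly_recurrent c I f \<longleftrightarrow>
    (\<exists>\<alpha> :: nat \<Rightarrow> real. strict_mono \<alpha> \<and> (\<forall>n. \<alpha> n > 0) \<and>
      filterlim \<alpha> at_top sequentially \<and>
      (\<lambda>n. SUP t\<in>I. ereal (norm (f (t + \<alpha> n) - c *\<^sub>C f t))) \<longlonglongrightarrow> 0)"

(* Only used for I = [0, \<infinity>), giving {1, 2, ...}, and I = \<real>, giving all integers. *)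

definition multipliers :: "real set \<Rightarrow> int set"
  where "multipliers I = (if I = UNIV then UNIV else {1..})"

definition semi_c_periodic ::
    "complex \<Rightarrow> real set \<Rightarrow> (real \<Rightarrow> 'a::complex_banach) \<Rightarrow> bool"
  where "semi_c_periodic c I f \<longleftrightarrow>
    (\<forall>\<epsilon>>0. \<exists>r>0. \<forall>m\<in>multipliers I. \<forall>x\<in>I.
      norm (f (x + of_int m * r) - (c powi m) *\<^sub>C f x) \<le> \<epsilon>)"

abbreviation "almost_periodic \<equiv> c_almost_periodic 1"
abbreviation "uniformly_recurrent \<equiv> c_uniformly_recurrent 1"
abbreviation "semi_periodic \<equiv> semi_c_periodic 1"
abbreviation "almost_anti_periodic \<equiv> c_almost_periodic (- 1)"
abbreviation "uniformly_anti_recurrent \<equiv> c_uniformly_recurrent (- 1)"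
abbreviation "semi_anti_periodic \<equiv> semi_c_periodic (- 1)"

end

theory Submission
  imports Defs
begin

text \<open>
  The number \<open>c\<close> is a root of \<open>1\<close> or of \<open>-1\<close>: since \<open>c = cis (pi * p / q)\<close>, its \<open>q\<close>-th power is
  \<open>cis (pi * p) = (-1) ^ p\<close>. Hence it suffices that each of the three notions for \<open>c\<close> implies the
  same notion for every positive power \<open>c ^ k\<close>, and to take \<open>k = q\<close>.

  This passage to powers consists in replacing a translation by its \<open>k\<close>-fold multiple. If shifting
  by \<open>\<tau>\<close> agrees with multiplication by \<open>c\<close> up to an error \<open>M\<close>, uniformly on \<open>I\<close>, then shifting
  \<open>k\<close> times agrees with multiplication by \<open>c ^ k\<close> up to \<open>k * M\<close>, because the errors of the single
  steps add up and multiplication by the unimodular \<open>c\<close> does not enlarge them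
  (\<open>iterated_shift_error\<close>). Multiplication by \<open>k\<close> also preserves relatively dense sets and strictly
  increasing unbounded sequences. Semi-\<open>c\<close>-periodicity already controls all multiples of
  the period \<open>r\<close>, so there one only restricts to the multiples of \<open>k * r\<close>.
\<close>

lemma scaleC_one: "(1::complex) *\<^sub>C x = (x::'a::complex_banach)"
  using scaleR_scaleC[of 1 x] by simp

lemma scaleC_diff_right: "a *\<^sub>C (x - y) = a *\<^sub>C x - a *\<^sub>C (y::'a::complex_banach)"
  using scaleC_add_right[of a "x - y" y] by (simp add: algebra_simps)

lemma iterated_shift_error:
  fixes f :: "real \<Rightarrow> 'a::complex_banach"
  assumes c: "cmod c = 1"
    and shift: "\<And>t. t \<in> I \<Longrightarrow> t + \<tau> \<in> I"
    and error: "\<And>t. t \<in> I \<Longrightarrow> norm (f (t + \<tau>) - c *\<^sub>C f t) \<le> M"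
    and t: "t \<in> I"
  shows "norm (f (t + of_nat k * \<tau>) - (c ^ k) *\<^sub>C f t) \<le> of_nat k * M"
  using t
proof (induction k arbitrary: t)
  case 0
  then show ?case by (simp add: scaleC_one)
next
  case (Suc k)
  let ?s = "t + \<tau>"
  have "f (t + of_nat (Suc k) * \<tau>) - (c ^ Suc k) *\<^sub>C f t
      = (f (?s + of_nat k * \<tau>) - (c ^ k) *\<^sub>C f ?s) + (c ^ k) *\<^sub>C (f ?s - c *\<^sub>C f t)"
    by (simp add: scaleC_diff_right scaleC_scaleC algebra_simps)
  also have "norm \<dots> \<le> norm (f (?s + of_nat k * \<tau>) - (c ^ k) *\<^sub>C f ?s)
      + norm ((c ^ k) *\<^sub>C (f ?s - c *\<^sub>C f t))"
    by (rule norm_triangle_ineq)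
  also have "\<dots> \<le> of_nat k * M + M"
    using Suc.IH[OF shift[OF Suc.prems]] error[OF Suc.prems]
    by (simp add: norm_scaleC norm_power c)
  finally show ?case by (simp add: algebra_simps)
qed

lemma relatively_dense_scale:
  assumes "relatively_dense T" and "k > 0"
  shows "relatively_dense ((\<lambda>\<tau>. k * \<tau>) ` T)"
proof -
  obtain L where L: "L > 0" "\<And>a. a \<ge> 0 \<Longrightarrow> {a..a + L} \<inter> T \<noteq> {}"
    using assms(1) unfolding relatively_dense_def by blast
  have "{a..a + k * L} \<inter> (\<lambda>\<tau>. k * \<tau>) ` T \<noteq> {}" if "a \<ge> 0" for a
  proof -
    obtain \<tau> where "\<tau> \<in> T" "a / k \<le> \<tau>" "\<tau> \<le> a / k + L"
      using L(2)[of "a / k"] \<open>a \<ge> 0\<close> \<open>k > 0\<close> by auto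
    moreover from this have "k * \<tau> \<in> {a..a + k * L}"
      using \<open>k > 0\<close> by (simp add: field_simps)
    ultimately show ?thesis by blast
  qed
  then show ?thesis
    unfolding relatively_dense_def using L(1) \<open>k > 0\<close> by (intro exI[of _ "k * L"]) simp
qed

lemma relatively_dense_mono: "relatively_dense S \<Longrightarrow> S \<subseteq> T \<Longrightarrow> relatively_dense T"
  unfolding relatively_dense_def by blast

lemma c_almost_periodic_power:
  assumes c: "cmod c = 1" and k: "k \<ge> 1"
    and shift: "\<And>t \<tau>. t \<in> I \<Longrightarrow> \<tau> > 0 \<Longrightarrow> t + \<tau> \<in> I"
    and f: "c_almost_periodic c I f"
  shows "c_almost_periodic (c ^ k) I f"
  unfolding c_almost_periodic_def
proof (intro allI impI)
  fix \<epsilon> :: real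
  assume "\<epsilon> > 0"
  define T where "T = {\<tau>. \<tau> > 0 \<and> (\<forall>t\<in>I. norm (f (t + \<tau>) - c *\<^sub>C f t) \<le> \<epsilon> / of_nat k)}"
  have "relatively_dense T"
    using f \<open>\<epsilon> > 0\<close> k unfolding c_almost_periodic_def T_def by simp
  then have "relatively_dense ((\<lambda>\<tau>. of_nat k * \<tau>) ` T)"
    by (rule relatively_dense_scale) (use k in simp)
  moreover have "norm (f (t + of_nat k * \<tau>) - (c ^ k) *\<^sub>C f t) \<le> \<epsilon>" if "\<tau> \<in> T" "t \<in> I" for \<tau> t
    using iterated_shift_error[of c I \<tau> f "\<epsilon> / of_nat k" t k] c shift that k
    by (simp add: T_def)
  then have "(\<lambda>\<tau>. of_nat k * \<tau>) ` T
      \<subseteq> {\<tau>. \<tau> > 0 \<and> (\<forall>t\<in>I. norm (f (t + \<tau>) - (c ^ k) *\<^sub>C f t) \<le> \<epsilon>)}"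
    using k by (auto simp: T_def)
  ultimately show "relatively_dense
      {\<tau>. \<tau> > 0 \<and> (\<forall>t\<in>I. norm (f (t + \<tau>) - (c ^ k) *\<^sub>C f t) \<le> \<epsilon>)}"
    by (rule relatively_dense_mono)
qed

text \<open>
  The supremum of the error may be \<open>\<infinity>\<close>; then the bound is trivial, but only because \<open>k\<close> is positive.
\<close>

lemma SUP_iterated_shift_error:
  fixes f :: "real \<Rightarrow> 'a::complex_banach"
  assumes c: "cmod c = 1" and k: "k \<ge> 1" and "I \<noteq> {}"
    and shift: "\<And>t. t \<in> I \<Longrightarrow> t + \<tau> \<in> I"
  shows "(SUP t\<in>I. ereal (norm (f (t + of_nat k * \<tau>) - (c ^ k) *\<^sub>C f t)))
    \<le> ereal (of_nat k) * (SUP t\<in>I. ereal (norm (f (t + \<tau>) - c *\<^sub>C f t)))"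
    (is "_ \<le> _ * ?S")
proof (cases ?S)
  case (real M)
  have "norm (f (t + \<tau>) - c *\<^sub>C f t) \<le> M" if "t \<in> I" for t
    using SUP_upper[of t I "\<lambda>t. ereal (norm (f (t + \<tau>) - c *\<^sub>C f t))"] that real by simp
  then have "norm (f (t + of_nat k * \<tau>) - (c ^ k) *\<^sub>C f t) \<le> of_nat k * M" if "t \<in> I" for t
    using iterated_shift_error[of c I \<tau> f M t k] c shift that by simp
  then show ?thesis
    unfolding real by (intro SUP_least) simp
next
  case PInf
  then show ?thesis using k by simp
next
  case MInf
  obtain t where "t \<in> I" using \<open>I \<noteq> {}\<close> by blast
  then show ?thesis
    using SUP_upper[of t I "\<lambda>t. ereal (norm (f (t + \<tau>) - c *\<^sub>C f t))"] MInf by simp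
qed

lemma c_uniformly_recurrent_power:
  fixes f :: "real \<Rightarrow> 'a::complex_banach"
  assumes c: "cmod c = 1" and k: "k \<ge> 1" and ne: "I \<noteq> {}"
    and shift: "\<And>t \<tau>. t \<in> I \<Longrightarrow> \<tau> > 0 \<Longrightarrow> t + \<tau> \<in> I"
    and f: "c_uniformly_recurrent c I f"
  shows "c_uniformly_recurrent (c ^ k) I f"
proof -
  obtain \<alpha> :: "nat \<Rightarrow> real" where \<alpha>: "strict_mono \<alpha>" "\<And>n. \<alpha> n > 0" "filterlim \<alpha> at_top sequentially"
    and lim: "(\<lambda>n. SUP t\<in>I. ereal (norm (f (t + \<alpha> n) - c *\<^sub>C f t))) \<longlonglongrightarrow> 0"
    using f unfolding c_uniformly_recurrent_def by blast
  have "(\<lambda>n. SUP t\<in>I. ereal (norm (f (t + of_nat k * \<alpha> n) - (c ^ k) *\<^sub>C f t))) \<longlonglongrightarrow> 0"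
  proof (rule tendsto_sandwich)
    obtain t where "t \<in> I" using ne by blast
    then show "\<forall>\<^sub>F n in sequentially.
        0 \<le> (SUP t\<in>I. ereal (norm (f (t + of_nat k * \<alpha> n) - (c ^ k) *\<^sub>C f t)))"
      by (intro always_eventually allI SUP_upper2[of t]) auto
    show "\<forall>\<^sub>F n in sequentially.
        (SUP t\<in>I. ereal (norm (f (t + of_nat k * \<alpha> n) - (c ^ k) *\<^sub>C f t)))
        \<le> ereal (of_nat k) * (SUP t\<in>I. ereal (norm (f (t + \<alpha> n) - c *\<^sub>C f t)))"
      by (intro always_eventually allI SUP_iterated_shift_error[OF c k ne] shift \<alpha>(2))
    show "(\<lambda>n. ereal (of_nat k) * (SUP t\<in>I. ereal (norm (f (t + \<alpha> n) - c *\<^sub>C f t)))) \<longlonglongrightarrow> 0"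
      using tendsto_cmult_ereal[OF _ lim, of "ereal (of_nat k)"] by simp
  qed simp
  moreover have "strict_mono (\<lambda>n. of_nat k * \<alpha> n)"
    using \<alpha>(1) k by (simp add: strict_mono_def)
  moreover have "\<And>n. of_nat k * \<alpha> n > 0"
    using \<alpha>(2) k by simp
  moreover have "filterlim (\<lambda>n. of_nat k * \<alpha> n) at_top sequentially"
    using \<alpha>(3) k by (intro filterlim_tendsto_pos_mult_at_top[OF tendsto_const]) auto
  ultimately show ?thesis
    unfolding c_uniformly_recurrent_def by (intro exI[of _ "\<lambda>n. of_nat k * \<alpha> n"]) blast
qed

lemma semi_c_periodic_power:
  assumes k: "k \<ge> 1" and f: "semi_c_periodic c I f"
  shows "semi_c_periodic (c ^ k) I f"
  unfolding semi_c_periodic_def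
proof (intro allI impI)
  fix \<epsilon> :: real
  assume "\<epsilon> > 0"
  then obtain r where "r > 0" and r: "\<And>m x. m \<in> multipliers I \<Longrightarrow> x \<in> I \<Longrightarrow>
      norm (f (x + of_int m * r) - (c powi m) *\<^sub>C f x) \<le> \<epsilon>"
    using f unfolding semi_c_periodic_def by meson
  have "norm (f (x + of_int m * (of_nat k * r)) - ((c ^ k) powi m) *\<^sub>C f x) \<le> \<epsilon>"
    if m: "m \<in> multipliers I" and "x \<in> I" for m x
  proof -
    have "int k * m \<in> multipliers I"
      using m k mult_mono[of 1 "int k" 1 m] by (auto simp: multipliers_def split: if_splits)
    moreover have "c powi (int k * m) = (c ^ k) powi m"
      by (simp add: power_int_mult)
    ultimately show ?thesis
      using r[of "int k * m" x] \<open>x \<in> I\<close> by (simp add: mult_ac)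
  qed
  then show "\<exists>r>0. \<forall>m\<in>multipliers I. \<forall>x\<in>I.
      norm (f (x + of_int m * r) - ((c ^ k) powi m) *\<^sub>C f x) \<le> \<epsilon>"
    using \<open>r > 0\<close> k by (intro exI[of _ "of_nat k * r"]) simp
qed

lemma power_of_Arg_rational_multiple_pi:
  assumes "cmod c = 1" and "q \<ge> 1" and "Arg c = pi * of_int p / of_nat q"
  shows "c ^ q = (if even p then 1 else - 1)"
proof -
  have "c = cis (Arg c)"
    using assms(1) rcis_cmod_Arg[of c] by (simp add: rcis_def)
  then have "c ^ q = cis (of_nat q * Arg c)"
    by (metis Complex.DeMoivre)
  also have "of_nat q * Arg c = of_int p * pi"
    using assms(2,3) by simp
  also have "cis (of_int p * pi) = (if even p then 1 else - 1)"
    by (auto simp: complex_eq_iff mult.commute[of _ pi] sin_npi_int cos_npi_int)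
  finally show ?thesis .
qed

theorem corollary2p10:
  fixes I :: "real set" and f :: "real \<Rightarrow> 'a::complex_banach"
    and c :: complex and p :: int and q :: nat
  assumes "I = UNIV \<or> I = {0..}"
    and "continuous_on I f"
    and "cmod c = 1"
    and "p \<noteq> 0" and "q \<ge> 1" and "gcd p (int q) = 1"
    and "Arg c = pi * of_int p / of_nat q"
  shows "(even p \<longrightarrow>
            (c_almost_periodic c I f \<longrightarrow> almost_periodic I f) \<and>
            (c_uniformly_recurrent c I f \<longrightarrow> uniformly_recurrent I f) \<and>
            (semi_c_periodic c I f \<longrightarrow> semi_periodic I f)) \<and>
         (odd p \<longrightarrow>
            (c_almost_periodic c I f \<longrightarrow> almost_anti_periodic I f) \<and>
            (c_uniformly_recurrent c I f \<longrightarrow> uniformly_anti_recurrent I f) \<and>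
            (semi_c_periodic c I f \<longrightarrow> semi_anti_periodic I f))"
proof -
  have shift: "t + \<tau> \<in> I" if "t \<in> I" "\<tau> > 0" for t \<tau>
    using assms(1) that by auto
  have "I \<noteq> {}"
    using assms(1) by auto
  note c_power = power_of_Arg_rational_multiple_pi[OF assms(3,5,7)]
  have "c_almost_periodic c I f \<longrightarrow> c_almost_periodic (c ^ q) I f"
    using c_almost_periodic_power[OF assms(3,5) shift] by blast
  moreover have "c_uniformly_recurrent c I f \<longrightarrow> c_uniformly_recurrent (c ^ q) I f"
    using c_uniformly_recurrent_power[OF assms(3,5) \<open>I \<noteq> {}\<close> shift] by blast
  moreover have "semi_c_periodic c I f \<longrightarrow> semi_c_periodic (c ^ q) I f"
    using semi_c_periodic_power[OF assms(5)] by blast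
  ultimately show ?thesis
    unfolding c_power by (cases "even p") simp_all
qed

end
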